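(* Let $k \geq 2$ and let $t, r_1, \dots, r_k$ be positive integers with $t \leq r_1 \leq \dots \leq r_k$. For positive integers $t \leq r \leq s$ define \[n_0(r,s,t) = \max\left\{r(s-t) {r+s-t \choose t}, \, (r-t){r \choose t} {r+s-t \choose t+1}\right\} + t+1,\] and let $n \geq n_0(r_{k-1},r_k,t)$. If $\mathcal{A}_1 \subseteq {[n] \choose r_1}, \dots, \mathcal{A}_k \subseteq {[n] \choose r_k}$ are cross-$t$-intersecting, then \[\prod_{i=1}^k |\mathcal{A}_i| \leq \prod_{i=1}^k {n-t \choose r_i - t},\] and equality holds if and only if for some $T \in {[n] \choose t}$, $\mathcal{A}_i = \{A \in {[n] \choose r_i} \colon T \subseteq A\}$ for each $i \in [k]$.
   Context: $[n] = \{1,\dots,n\}$ and ${X \choose r}$ denotes the family of all $r$-element subsets of $X$. Families $\mathcal{A}_1, \dots, \mathcal{A}_k$ are cross-$t$-intersecting if for all distinct $i,j \in [k]$, $|A \cap B| \geq t$ for every $A \in \mathcal{A}_i$ and every $B \in \mathcal{A}_j$. The families may be empty. *)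

theory Defs
  imports Complex_Main "HOL-Library.Ramsey"
begin

text \<open>
  The family of all \<open>r\<close>-element subsets of \<open>X\<close> is \<^const>\<open>nsets\<close> from
  \<^theory>\<open>HOL-Library.Ramsey\<close>, written \<open>[X]\<^bsup>r\<^esup>\<close>.
\<close>

definition cross_intersecting :: "nat \<Rightarrow> 'i set \<Rightarrow> ('i \<Rightarrow> 'a set set) \<Rightarrow> bool" where
  "cross_intersecting t I \<A> \<longleftrightarrow>
     (\<forall>i\<in>I. \<forall>j\<in>I. i \<noteq> j \<longrightarrow> (\<forall>A\<in>\<A> i. \<forall>B\<in>\<A> j. t \<le> card (A \<inter> B)))"

text \<open>
  Only meant for \<open>0 < t \<le> r \<le> s\<close>, where no subtraction below truncates.
\<close>

definition n0 :: "nat \<Rightarrow> nat \<Rightarrow> nat \<Rightarrow> nat" where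
  "n0 r s t =
     max (r * (s - t) * ((r + s - t) choose t))
         ((r - t) * (r choose t) * ((r + s - t) choose (t + 1))) + t + 1"

end

theory Submission
  imports Defs
begin

text \<open>
  For two families, either one \<open>t\<close>-set lies in all members of both, or the product is strictly
  too small. Indeed, members of the second family each contain one of the \<open>r choose t\<close> many
  \<open>t\<close>-subsets of a fixed member of the first; and a \<open>t\<close>-set \<open>T\<close> that is missed by some
  member \<open>A\<close> of the first forces a further element of \<open>A - T\<close> into every member of the
  second that contains \<open>T\<close>, which saves a factor of order \<open>n\<close>. For \<open>k\<close> families, the ratios
  of the sizes to their bounds have pairwise products at most 1, so at most one ratio exceeds 1,
  and it is compensated by any other one.
\<close>

section \<open>Stars: the \<open>r\<close>-sets containing a fixed set\<close>

definition star :: "'a set \<Rightarrow> nat \<Rightarrow> 'a set \<Rightarrow> 'a set set" where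
  "star X r T = {A \<in> [X]\<^bsup>r\<^esup>. T \<subseteq> A}"

lemma finite_star [simp]: "finite X \<Longrightarrow> finite (star X r T)"
  unfolding star_def by (simp add: finite_imp_finite_nsets)

lemma card_star:
  assumes "finite X" "T \<subseteq> X" "card T \<le> r"
  shows "card (star X r T) = (card X - card T) choose (r - card T)"
proof -
  have fT: "finite T"
    using assms finite_subset by blast
  have "bij_betw (\<lambda>B. B \<union> T) ([X - T]\<^bsup>(r - card T)\<^esup>) (star X r T)"
  proof (rule bij_betw_byWitness[where f' = "\<lambda>A. A - T"])
    show "(\<lambda>B. B \<union> T) ` ([X - T]\<^bsup>(r - card T)\<^esup>) \<subseteq> star X r T"
    proof safe
      fix B assume B: "B \<in> [X - T]\<^bsup>(r - card T)\<^esup>"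
      then have "card (B \<union> T) = card B + card T"
        using fT by (intro card_Un_disjoint) (auto simp: nsets_def)
      then show "B \<union> T \<in> star X r T"
        using B assms fT by (auto simp: nsets_def star_def)
    qed
    show "(\<lambda>A. A - T) ` star X r T \<subseteq> [X - T]\<^bsup>(r - card T)\<^esup>"
      using fT by (auto simp: nsets_def star_def card_Diff_subset)
  qed (auto simp: nsets_def star_def)
  then have "card (star X r T) = card ([X - T]\<^bsup>(r - card T)\<^esup>)"
    by (rule bij_betw_same_card[symmetric])
  then show ?thesis
    using assms fT by (simp add: card_nsets card_Diff_subset)
qed

lemma star_eq_empty: "r < card T \<Longrightarrow> star X r T = {}"
  unfolding star_def nsets_def by (auto dest: card_mono)

text \<open>Two distinct \<open>t\<close>-sets are incomparable, so some \<open>x\<close> lies in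
  \<open>T'\<close> only. The strict bound \<open>r < card X\<close> leaves room to extend
  \<open>T\<close> to an \<open>r\<close>-set avoiding \<open>x\<close>. This later identifies the
  \<open>t\<close>-sets found for different pairs of families.\<close>

lemma star_inject:
  assumes "finite X" "T \<in> [X]\<^bsup>t\<^esup>" "T' \<in> [X]\<^bsup>t\<^esup>" "t \<le> r" "r < card X"
    and eq: "star X r T = star X r T'"
  shows "T = T'"
proof (rule ccontr)
  assume "T \<noteq> T'"
  then have "\<not> T' \<subseteq> T"
    using assms(2,3) card_subset_eq[of T T'] by (auto simp: nsets_def)
  then obtain x where x: "x \<in> T'" "x \<notin> T"
    by blast
  then have "T \<subseteq> X - {x}" "card T \<le> r" "r \<le> card (X - {x})" "finite (X - {x})"
    using assms(1-5) by (auto simp: nsets_def card_Diff_singleton_if)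
  then obtain F where "T \<subseteq> F" "F \<subseteq> X - {x}" "card F = r"
    using exists_subset_between by metis
  moreover have "finite F"
    using \<open>F \<subseteq> X - {x}\<close> \<open>finite (X - {x})\<close> by (rule finite_subset)
  ultimately have "F \<in> star X r T" "F \<notin> star X r T'"
    using x by (auto simp: star_def nsets_def)
  then show False
    using eq by simp
qed

section \<open>Upper bounds on families that meet a fixed set in at least \<open>t\<close>
  elements\<close>

text \<open>Since \<open>A\<close> omits part of \<open>T\<close>, intersecting within
  \<open>T\<close> alone gives fewer than \<open>t\<close> elements, so each member of
  \<open>\<F>\<close> contains \<open>insert x T\<close> for one of at most \<open>r\<close>
  elements \<open>x\<close> of \<open>A - T\<close>. Binomial absorption turns the size of these
  smaller stars into a fraction of the full star; multiplying by \<open>card X - t\<close> keeps the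
  bound free of division.\<close>

lemma card_star_missed_le:
  assumes X: "finite X" and T: "T \<in> [X]\<^bsup>t\<^esup>" and F: "\<F> \<subseteq> star X s T"
    and A: "A \<in> [X]\<^bsup>r\<^esup>" "\<not> T \<subseteq> A" and int: "\<And>B. B \<in> \<F> \<Longrightarrow> t \<le> card (A \<inter> B)"
  shows "(card X - t) * card \<F> \<le> r * (s - t) * ((card X - t) choose (s - t))"
proof -
  have sub: "\<F> \<subseteq> (\<Union>x\<in>A - T. star X s (insert x T))"
  proof
    fix B assume B: "B \<in> \<F>"
    have "\<not> A \<inter> B \<subseteq> T"
    proof
      assume "A \<inter> B \<subseteq> T"
      with A have "A \<inter> B \<subset> T"
        by blast
      then have "card (A \<inter> B) < t"
        using T psubset_card_mono by (auto simp: nsets_def)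
      then show False
        using int[OF B] by simp
    qed
    then show "B \<in> (\<Union>x\<in>A - T. star X s (insert x T))"
      using B F by (auto simp: star_def)
  qed
  have fA: "finite A" and cA: "card A = r" and AX: "A \<subseteq> X"
    using A by (auto simp: nsets_def)
  have fT: "finite T" and cT: "card T = t" and TX: "T \<subseteq> X"
    using T by (auto simp: nsets_def)
  show ?thesis
  proof (cases "t < s")
    case True
    have "card \<F> \<le> card (\<Union>x\<in>A - T. star X s (insert x T))"
      using sub fA X by (intro card_mono) auto
    also have "\<dots> \<le> (\<Sum>x\<in>A - T. card (star X s (insert x T)))"
      using fA by (intro card_UN_le) auto
    also have "\<dots> = (\<Sum>x\<in>A - T. (card X - Suc t) choose (s - Suc t))"
      using True AX TX fT cT X by (intro sum.cong refl) (subst card_star, auto)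
    also have "\<dots> = card (A - T) * ((card X - Suc t) choose (s - Suc t))"
      by simp
    also have "\<dots> \<le> r * ((card X - Suc t) choose (s - Suc t))"
      using fA cA by (intro mult_right_mono) (auto intro: card_mono)
    finally have "(card X - t) * card \<F> \<le> r * ((card X - t) * ((card X - Suc t) choose (s - Suc t)))"
      by (simp add: mult.left_commute mult_left_mono)
    also have "(card X - t) * ((card X - Suc t) choose (s - Suc t))
        = (s - t) * ((card X - t) choose (s - t))"
      using binomial_absorption[of "s - Suc t" "card X - t"] True
      by (simp add: Suc_diff_Suc)
    finally show ?thesis
      by (simp add: mult.assoc)
  next
    case False
    \<comment> \<open>Here \<open>s \<le> t\<close>, so truncated subtraction makes the right-hand
      side 0; an \<open>s\<close>-set is too small to contain the \<open>t + 1\<close> elements of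
      \<open>insert x T\<close>.\<close>
    then have "star X s (insert x T) = {}" if "x \<in> A - T" for x
      using that fT cT by (intro star_eq_empty) auto
    then have "\<F> = {}"
      using sub by auto
    then show ?thesis
      by simp
  qed
qed

text \<open>The family is covered by its parts in the stars of the \<open>t\<close>-subsets of
  \<open>A\<close>. The weight \<open>c\<close> lets one covering argument serve both the trivial
  bound on each part (\<open>c = 1\<close>) and the improved bound for missed sets
  (\<open>c = card X - t\<close>).\<close>

lemma card_family_le:
  assumes X: "finite X" and F: "\<F> \<subseteq> [X]\<^bsup>s\<^esup>" and A: "A \<in> [X]\<^bsup>r\<^esup>"
    and int: "\<And>B. B \<in> \<F> \<Longrightarrow> t \<le> card (A \<inter> B)"
    and M: "\<And>T. T \<in> [X]\<^bsup>t\<^esup> \<Longrightarrow> c * card (\<F> \<inter> star X s T) \<le> M"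
  shows "c * card \<F> \<le> (r choose t) * M"
proof -
  have fA: "finite A" and cA: "card A = r" and AX: "A \<subseteq> X"
    using A by (auto simp: nsets_def)
  have sub: "\<F> \<subseteq> (\<Union>T\<in>[A]\<^bsup>t\<^esup>. \<F> \<inter> star X s T)"
  proof
    fix B assume B: "B \<in> \<F>"
    obtain T where "T \<subseteq> A \<inter> B" "card T = t" "finite T"
      using obtain_subset_with_card_n[OF int[OF B]] by blast
    then show "B \<in> (\<Union>T\<in>[A]\<^bsup>t\<^esup>. \<F> \<inter> star X s T)"
      using B F by (auto simp: star_def nsets_def)
  qed
  have "card \<F> \<le> card (\<Union>T\<in>[A]\<^bsup>t\<^esup>. \<F> \<inter> star X s T)"
    using sub fA X by (intro card_mono) (auto simp: finite_imp_finite_nsets)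
  also have "\<dots> \<le> (\<Sum>T\<in>[A]\<^bsup>t\<^esup>. card (\<F> \<inter> star X s T))"
    using fA by (intro card_UN_le finite_imp_finite_nsets)
  finally have "c * card \<F> \<le> (\<Sum>T\<in>[A]\<^bsup>t\<^esup>. c * card (\<F> \<inter> star X s T))"
    unfolding sum_distrib_left[symmetric] by (rule mult_le_mono2)
  also have "\<dots> \<le> (\<Sum>T\<in>[A]\<^bsup>t\<^esup>. M)"
    using AX M by (intro sum_mono) (auto simp: nsets_def)
  also have "\<dots> = (r choose t) * M"
    using fA cA by (simp add: card_nsets)
  finally show ?thesis .
qed

section \<open>Numerical consequences of the threshold \<open>n0\<close>\<close>

lemma le_binomial:
  assumes "0 < k" "k < n"
  shows "n \<le> n choose k"
  using assms
proof (induction n arbitrary: k)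
  case (Suc n)
  obtain j where j: "k = Suc j"
    using Suc.prems gr0_implies_Suc by blast
  show ?case
  proof (cases "k = n")
    case False
    then have "n \<le> n choose k" "0 < n choose j"
      using Suc by (auto simp: j)
    then show ?thesis
      unfolding j binomial_Suc_Suc by linarith
  qed simp
qed simp

text \<open>The first term of the maximum is at least \<open>s - t\<close>, and the summand
  \<open>t + 1\<close> lifts this above \<open>s\<close>. It makes the binomial bounds positive and
  makes \<open>star_inject\<close> applicable.\<close>

lemma n0_gt:
  assumes "0 < t" "t \<le> r" "r \<le> s"
  shows "s < n0 r s t"
proof -
  have "s - t \<le> r * (s - t) * ((r + s - t) choose t)"
  proof -
    have "1 \<le> r * ((r + s - t) choose t)"
      using assms by (simp add: Suc_le_eq)
    then have "(s - t) * 1 \<le> (s - t) * (r * ((r + s - t) choose t))"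
      by (rule mult_le_mono2)
    then show ?thesis
      by (simp add: ac_simps)
  qed
  also have "\<dots> \<le> n0 r s t - (t + 1)"
    unfolding n0_def by simp
  finally have "s - t \<le> n0 r s t - (t + 1)" .
  moreover have "t + 1 \<le> n0 r s t"
    by (simp add: n0_def)
  ultimately show ?thesis
    by linarith
qed

text \<open>Carries the hypothesis on \<open>n\<close>, given for the last two sizes only, to every
  pair of sizes.\<close>

lemma n0_mono:
  assumes "r \<le> r'" "s \<le> s'" "t \<le> r" "r \<le> s"
  shows "n0 r s t \<le> n0 r' s' t"
  unfolding n0_def
  using assms
  by (intro add_right_mono max.mono mult_mono binomial_right_mono) auto

text \<open>The left-hand sides are the coefficients that arise in the three cases of
  \<open>cross_intersecting_pair\<close> without a common \<open>T\<close>. The third is the product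
  of the first two, regrouped. The final \<open>+ 1\<close> in \<open>n0\<close> gives strictness;
  \<open>t < r\<close> ensures \<open>t + 1 < r + s - t\<close>, as \<open>le_binomial\<close>
  requires.\<close>

lemma n0_bounds:
  assumes "0 < t" "t \<le> r" "r \<le> s" "n0 r s t \<le> n"
  shows "r * (s - t) * (s choose t) < n - t"
    and "t < r \<Longrightarrow> (r - t) * (r choose t) * s < n - t"
    and "t < r \<Longrightarrow> (r * (s - t) * (r choose t)) * (s * (r - t) * (s choose t)) < (n - t) * (n - t)"
proof -
  let ?p = "r * (s - t) * ((r + s - t) choose t)"
  let ?q = "(r - t) * (r choose t) * ((r + s - t) choose (t + 1))"
  have p: "?p < n - t" and q: "?q < n - t"
    using assms(4) by (auto simp: n0_def)
  have st: "s choose t \<le> (r + s - t) choose t"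
    using assms by (intro binomial_right_mono) auto
  have p': "r * (s - t) * (s choose t) \<le> ?p"
    using st by simp
  then show "r * (s - t) * (s choose t) < n - t"
    using p by linarith
  assume tr: "t < r"
  have "s \<le> (r + s - t) choose (t + 1)"
    using le_binomial[of "t + 1" "r + s - t"] tr assms by linarith
  then have q': "(r - t) * (r choose t) * s \<le> ?q"
    by (rule mult_le_mono2)
  then show "(r - t) * (r choose t) * s < n - t"
    using q by linarith
  have "(r * (s - t) * (r choose t)) * (s * (r - t) * (s choose t))
      = (r * (s - t) * (s choose t)) * ((r - t) * (r choose t) * s)"
    by (simp add: ac_simps)
  also have "\<dots> \<le> ?p * ?q"
    using p' q' by (rule mult_le_mono)
  also have "\<dots> < (n - t) * (n - t)"
    using p q by (intro mult_strict_mono) auto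
  finally show "(r * (s - t) * (r choose t)) * (s * (r - t) * (s choose t)) < (n - t) * (n - t)" .
qed

section \<open>The case of two families\<close>

text \<open>The cases ask which of the families can lie in the star of a single
  \<open>t\<close>-set. Without a \<open>t\<close>-set common to both, at least one family gains a
  factor of order \<open>1 / ?m\<close> from a missed set, which outweighs the binomial factors lost
  in the covering.\<close>

lemma cross_intersecting_pair:
  assumes X: "finite X" and t: "0 < t" "t \<le> r" "r \<le> s" and n: "n0 r s t \<le> card X"
    and A: "\<A> \<subseteq> [X]\<^bsup>r\<^esup>" and B: "\<B> \<subseteq> [X]\<^bsup>s\<^esup>"
    and int: "\<And>A B. A \<in> \<A> \<Longrightarrow> B \<in> \<B> \<Longrightarrow> t \<le> card (A \<inter> B)"
  shows "card \<A> * card \<B> < ((card X - t) choose (r - t)) * ((card X - t) choose (s - t))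
    \<or> (\<exists>T\<in>[X]\<^bsup>t\<^esup>. \<A> \<subseteq> star X r T \<and> \<B> \<subseteq> star X s T)"
    (is "_ < ?a * ?b \<or> _")
proof -
  let ?m = "card X - t"
  have "s < card X"
    using n0_gt[OF t] n by linarith
  then have pos: "0 < ?a * ?b" "0 < ?m"
    using t by auto
  have int': "t \<le> card (B \<inter> A)" if "A \<in> \<A>" "B \<in> \<B>" for A B
    using int[OF that] by (simp add: Int_commute)
  \<comment> \<open>Common end of the cases without a common \<open>T\<close>: only the coefficients
    remain to be compared, with \<open>c\<close> being \<open>?m\<close> or
    \<open>?m * ?m\<close>.\<close>
  have concl: ?thesis if "c * (card \<A> * card \<B>) \<le> d * (?a * ?b)" "d < c" for c d
  proof -
    have "d * (?a * ?b) < c * (?a * ?b)"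
      using that(2) pos(1) by (rule mult_strict_right_mono)
    with that(1) have "c * (card \<A> * card \<B>) < c * (?a * ?b)"
      by linarith
    then show ?thesis
      by simp
  qed
  have missedA: "?m * card \<F> \<le> s * (r - t) * ?a"
    if "T \<in> [X]\<^bsup>t\<^esup>" "\<F> \<subseteq> \<A>" "\<F> \<subseteq> star X r T" and missed: "\<not> \<B> \<subseteq> star X s T" for \<F> T
  proof -
    obtain B0 where "B0 \<in> \<B>" "\<not> T \<subseteq> B0"
      using missed B by (auto simp: star_def)
    then show ?thesis
      using that B int' by (intro card_star_missed_le[OF X that(1,3), of B0]) auto
  qed
  have missedB: "?m * card \<F> \<le> r * (s - t) * ?b"
    if "T \<in> [X]\<^bsup>t\<^esup>" "\<F> \<subseteq> \<B>" "\<F> \<subseteq> star X s T" and missed: "\<not> \<A> \<subseteq> star X r T" for \<F> T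
  proof -
    obtain A0 where "A0 \<in> \<A>" "\<not> T \<subseteq> A0"
      using missed A by (auto simp: star_def)
    then show ?thesis
      using that A int by (intro card_star_missed_le[OF X that(1,3), of A0]) auto
  qed
  show ?thesis
  proof (cases "\<A> = {} \<or> \<B> = {}")
    case True
    then have "card \<A> * card \<B> = 0"
      by auto
    then show ?thesis
      using pos(1) by linarith
  next
    case False
    then obtain A0 B0 where A0: "A0 \<in> \<A>" and B0: "B0 \<in> \<B>"
      by auto
    \<comment> \<open>Each family is covered through the \<open>t\<close>-subsets of a member of the
      other one, so the factor for \<open>\<A>\<close> is \<open>s choose t\<close> and that for
      \<open>\<B>\<close> is \<open>r choose t\<close>.\<close>
    note famA = card_family_le[OF X A subsetD[OF B B0] int'[OF _ B0]]
    note famB = card_family_le[OF X B subsetD[OF A A0] int[OF A0]]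
    have star_le: "1 * card (\<F> \<inter> star X q T) \<le> (?m choose (q - t))"
      if "T \<in> [X]\<^bsup>t\<^esup>" "t \<le> q" for \<F> q T
    proof -
      have "card (\<F> \<inter> star X q T) \<le> card (star X q T)"
        using X by (intro card_mono) auto
      then show ?thesis
        using that card_star[OF X, of T q] by (auto simp: nsets_def)
    qed
    have boundA: "card \<A> \<le> (s choose t) * ?a"
      using famA[of 1 ?a] star_le t by simp
    have boundB: "card \<B> \<le> (r choose t) * ?b"
      using famB[of 1 ?b] star_le t by simp
    consider (both) T where "T \<in> [X]\<^bsup>t\<^esup>" "\<A> \<subseteq> star X r T" "\<B> \<subseteq> star X s T"
      | (onlyB) T where "T \<in> [X]\<^bsup>t\<^esup>" "\<not> \<A> \<subseteq> star X r T" "\<B> \<subseteq> star X s T"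
      | (onlyA) T where "T \<in> [X]\<^bsup>t\<^esup>" "\<A> \<subseteq> star X r T" "\<not> \<B> \<subseteq> star X s T"
      | (none) "\<And>T. T \<in> [X]\<^bsup>t\<^esup> \<Longrightarrow> \<not> \<A> \<subseteq> star X r T \<and> \<not> \<B> \<subseteq> star X s T"
      by blast
    then show ?thesis
    proof cases
      case both
      then show ?thesis
        by blast
    next
      case onlyB
      have "?m * (card \<A> * card \<B>) = card \<A> * (?m * card \<B>)"
        by simp
      also have "\<dots> \<le> ((s choose t) * ?a) * (r * (s - t) * ?b)"
        by (intro mult_le_mono boundA missedB[OF onlyB(1) subset_refl onlyB(3,2)])
      also have "\<dots> = (r * (s - t) * (s choose t)) * (?a * ?b)"
        by (simp add: ac_simps)
      finally show ?thesis
        using concl n0_bounds(1)[OF t n] by blast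
    next
      case onlyA
      have mA: "?m * card \<A> \<le> s * (r - t) * ?a"
        using missedA onlyA by auto
      \<comment> \<open>If \<open>r = t\<close>, the factor \<open>r - t\<close> in
        \<open>mA\<close> would force \<open>\<A>\<close> to be empty. So \<open>t < r\<close>,
        which the second bound on \<open>n\<close> requires.\<close>
      have "0 < card \<A>"
        using A0 A X by (metis card_gt_0_iff empty_iff finite_imp_finite_nsets finite_subset)
      then have "r \<noteq> t"
        using mA pos(2) by (cases "r = t") auto
      then have "t < r"
        using t by simp
      have "?m * (card \<A> * card \<B>) = (?m * card \<A>) * card \<B>"
        by simp
      also have "\<dots> \<le> (s * (r - t) * ?a) * ((r choose t) * ?b)"
        using mA boundB by (rule mult_le_mono)
      also have "\<dots> = ((r - t) * (r choose t) * s) * (?a * ?b)"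
        by (simp add: ac_simps)
      finally show ?thesis
        using concl n0_bounds(2)[OF t n \<open>t < r\<close>] by blast
    next
      case none
      \<comment> \<open>Every \<open>T\<close> is now missed by a member of each family, so the
        saving applies to every part of both coverings and yields two factors
        \<open>?m\<close>.\<close>
      have mA: "?m * card \<A> \<le> (s choose t) * (s * (r - t) * ?a)"
        using none by (intro famA missedA) auto
      have mB: "?m * card \<B> \<le> (r choose t) * (r * (s - t) * ?b)"
        using none by (intro famB missedB) auto
      have "0 < card \<A>"
        using A0 A X by (metis card_gt_0_iff empty_iff finite_imp_finite_nsets finite_subset)
      then have "r \<noteq> t"
        using mA pos(2) by (cases "r = t") auto
      then have "t < r"
        using t by simp
      have "(?m * ?m) * (card \<A> * card \<B>) = (?m * card \<A>) * (?m * card \<B>)"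
        by (simp add: ac_simps)
      also have "\<dots> \<le> ((s choose t) * (s * (r - t) * ?a)) * ((r choose t) * (r * (s - t) * ?b))"
        using mA mB by (rule mult_le_mono)
      also have "\<dots> = ((r * (s - t) * (r choose t)) * (s * (r - t) * (s choose t))) * (?a * ?b)"
        by (simp add: ac_simps)
      finally show ?thesis
        using concl n0_bounds(3)[OF t n \<open>t < r\<close>] by blast
    qed
  qed
qed

section \<open>From pairwise products to the full product\<close>

text \<open>If every factor outside \<open>{i, j}\<close> is at most 1, the pair \<open>i, j\<close>
  decides. Otherwise some other \<open>x m\<close> exceeds 1, which pushes all remaining factors
  strictly below 1; \<open>m\<close> is then paired with \<open>i\<close>.\<close>

lemma prod_less_1_of_pairs:
  fixes x :: "'i \<Rightarrow> 'b :: linordered_field"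
  assumes I: "finite I" "i \<in> I" "j \<in> I" "i \<noteq> j"
    and nonneg: "\<And>l. l \<in> I \<Longrightarrow> 0 \<le> x l"
    and pairs: "\<And>l m. l \<in> I \<Longrightarrow> m \<in> I \<Longrightarrow> l \<noteq> m \<Longrightarrow> x l * x m \<le> 1"
    and less: "x i * x j < 1"
  shows "(\<Prod>l\<in>I. x l) < 1"
proof -
  have split: "(\<Prod>l\<in>I. x l) = x p * x q * (\<Prod>l\<in>I - {p, q}. x l)"
    if "p \<in> I" "q \<in> I" "p \<noteq> q" for p q
  proof -
    have "I - {p} - {q} = I - {p, q}"
      by auto
    then show ?thesis
      using that I(1) prod.remove[of I p x] prod.remove[of "I - {p}" q x] by (simp add: ac_simps)
  qed
  show ?thesis
  proof (cases "\<forall>l\<in>I - {i, j}. x l \<le> 1")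
    case True
    then have "(\<Prod>l\<in>I - {i, j}. x l) \<le> 1"
      using nonneg by (intro prod_le_1) auto
    then have "(\<Prod>l\<in>I. x l) \<le> x i * x j"
      using split[OF I(2-4)] nonneg I by (simp add: mult_left_le)
    then show ?thesis
      using less by simp
  next
    case False
    then obtain m where m: "m \<in> I" "m \<noteq> i" "m \<noteq> j" "1 < x m"
      by (auto simp: not_le)
    have lt: "x l < 1" if "l \<in> I" "l \<noteq> m" for l
    proof (rule ccontr)
      assume "\<not> x l < 1"
      then have "1 * 1 < x m * x l"
        using m by (intro mult_less_le_imp_less) auto
      then show False
        using pairs[of m l] that m by auto
    qed
    \<comment> \<open>The index \<open>j\<close> survives the removal of \<open>m\<close> and
      \<open>i\<close>, so this product has a factor below 1: that is the source of
      strictness.\<close>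
    have "(\<Prod>l\<in>I - {m, i}. x l) = x j * (\<Prod>l\<in>I - {m, i} - {j}. x l)"
      using I m by (intro prod.remove) auto
    also have "\<dots> \<le> x j"
      using lt nonneg I by (intro mult_left_le prod_le_1) (auto intro: less_imp_le)
    also have "\<dots> < 1"
      using lt I m by auto
    finally have rest: "(\<Prod>l\<in>I - {m, i}. x l) < 1" .
    have "(\<Prod>l\<in>I. x l) = x m * x i * (\<Prod>l\<in>I - {m, i}. x l)"
      using split m I by blast
    also have "\<dots> \<le> 1 * (\<Prod>l\<in>I - {m, i}. x l)"
      using pairs[of m i] m I nonneg by (intro mult_right_mono prod_nonneg) auto
    finally show ?thesis
      using rest by simp
  qed
qed

section \<open>The case of \<open>k\<close> families\<close>

theorem theorem2:
  fixes k t n :: nat and r :: "nat \<Rightarrow> nat" and \<A> :: "nat \<Rightarrow> nat set set"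
  assumes "k \<ge> 2" and "t \<ge> 1"
    and "t \<le> r 1" and "mono_on {1..k} r"
    and "n \<ge> n0 (r (k - 1)) (r k) t"
    and "\<And>i. i \<in> {1..k} \<Longrightarrow> \<A> i \<subseteq> [{1..n}]\<^bsup>r i\<^esup>"
    and "cross_intersecting t {1..k} \<A>"
  shows "(\<Prod>i=1..k. card (\<A> i)) \<le> (\<Prod>i=1..k. (n - t) choose (r i - t)) \<and>
    ((\<Prod>i=1..k. card (\<A> i)) = (\<Prod>i=1..k. (n - t) choose (r i - t)) \<longleftrightarrow>
      (\<exists>T \<in> [{1..n}]\<^bsup>t\<^esup>. \<forall>i\<in>{1..k}. \<A> i = {A \<in> [{1..n}]\<^bsup>r i\<^esup>. T \<subseteq> A}))"
proof -
  define X where "X = {1..n}"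
  define I where "I = {1..k}"
  define b where "b = (\<lambda>i. (n - t) choose (r i - t))"
  have X [simp]: "finite X" "card X = n" and I [simp]: "finite I"
    by (auto simp: X_def I_def)
  have mono: "r i \<le> r j" if "i \<in> I" "j \<in> I" "i \<le> j" for i j
    using assms(4) that by (auto simp: mono_on_def I_def)
  have tr: "t \<le> r i" if "i \<in> I" for i
    using mono[of 1 i] assms(3) that by (auto simp: I_def)
  have k: "1 \<in> I" "2 \<in> I" "k - 1 \<in> I" "k \<in> I"
    using assms(1) by (auto simp: I_def)
  have rn: "r i < n" if "i \<in> I" for i
    using n0_gt[of t "r (k - 1)" "r k"] assms(2,5) tr[OF k(3)] mono[OF k(3,4)] mono[OF that k(4)] that
    by (auto simp: I_def)
  have fam: "\<A> i \<subseteq> [X]\<^bsup>r i\<^esup>" if "i \<in> I" for i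
    using assms(6) that by (simp add: X_def I_def)
  have card_star_b: "card (star X (r i) T) = b i" if "T \<in> [X]\<^bsup>t\<^esup>" "i \<in> I" for T i
    using card_star[of X T "r i"] tr that by (auto simp: nsets_def b_def)
  have bpos: "0 < b i" if "i \<in> I" for i
    using rn[OF that] by (simp add: b_def)
  have pair_less: "card (\<A> i) * card (\<A> j) < b i * b j
      \<or> (\<exists>T\<in>[X]\<^bsup>t\<^esup>. \<A> i \<subseteq> star X (r i) T \<and> \<A> j \<subseteq> star X (r j) T)"
    if "i \<in> I" "j \<in> I" "i < j" for i j
  proof -
    \<comment> \<open>From \<open>i < j \<le> k\<close> follows \<open>i \<le> k - 1\<close>, so the
      sizes at \<open>k - 1\<close> and \<open>k\<close> dominate this pair.\<close>
    have "r i \<le> r (k - 1)" "r j \<le> r k" "r i \<le> r j"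
      using that by (auto intro!: mono simp: I_def)
    then have "n0 (r i) (r j) t \<le> card X"
      using n0_mono[of "r i" "r (k - 1)" "r j" "r k" t] tr[OF that(1)] assms(5) by simp
    moreover have "t \<le> card (A \<inter> B)" if "A \<in> \<A> i" "B \<in> \<A> j" for A B
      using assms(7) that \<open>i \<in> I\<close> \<open>j \<in> I\<close> \<open>i < j\<close>
      unfolding cross_intersecting_def I_def by (metis less_irrefl)
    ultimately show ?thesis
      using cross_intersecting_pair[of X t "r i" "r j" "\<A> i" "\<A> j"] that fam tr \<open>r i \<le> r j\<close> assms(2)
      by (simp add: b_def)
  qed
  have pair: "card (\<A> i) * card (\<A> j) < b i * b j
      \<or> (\<exists>T\<in>[X]\<^bsup>t\<^esup>. \<A> i \<subseteq> star X (r i) T \<and> \<A> j \<subseteq> star X (r j) T)"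
    if "i \<in> I" "j \<in> I" "i \<noteq> j" for i j
    using pair_less[of i j] pair_less[of j i] that by (auto simp: neq_iff mult.commute)
  have le_b: "card (\<A> i) \<le> b i" if "T \<in> [X]\<^bsup>t\<^esup>" "\<A> i \<subseteq> star X (r i) T" "i \<in> I" for i T
    using card_mono[OF _ that(2)] card_star_b[OF that(1,3)] by simp
  have eq_star: "\<A> i = star X (r i) T"
    if "T \<in> [X]\<^bsup>t\<^esup>" "\<A> i \<subseteq> star X (r i) T" "i \<in> I" "card (\<A> i) = b i" for i T
    using card_subset_eq[OF _ that(2)] card_star_b[OF that(1,3)] that(4) by simp
  have eq_if: "(\<Prod>i\<in>I. card (\<A> i)) = (\<Prod>i\<in>I. b i)"
    if "T \<in> [X]\<^bsup>t\<^esup>" "\<forall>i\<in>I. \<A> i = star X (r i) T" for T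
    using that card_star_b by (intro prod.cong) auto
  \<comment> \<open>Only one direction of the equality case is treated here; the converse is
    \<open>eq_if\<close>.\<close>
  have "(\<Prod>i\<in>I. card (\<A> i)) \<le> (\<Prod>i\<in>I. b i) \<and>
      ((\<Prod>i\<in>I. card (\<A> i)) = (\<Prod>i\<in>I. b i) \<longrightarrow>
        (\<exists>T\<in>[X]\<^bsup>t\<^esup>. \<forall>i\<in>I. \<A> i = star X (r i) T))"
  proof (cases "\<exists>i\<in>I. \<exists>j\<in>I. i \<noteq> j \<and> card (\<A> i) * card (\<A> j) < b i * b j")
    case True
    then obtain i j where ij: "i \<in> I" "j \<in> I" "i \<noteq> j" "card (\<A> i) * card (\<A> j) < b i * b j"
      by blast
    \<comment> \<open>A single strict pair makes the whole product strict, via the ratios of sizes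
      to bounds; equality is then impossible.\<close>
    define x where "x = (\<lambda>i. real (card (\<A> i)) / real (b i))"
    have "x l * x m \<le> 1" if "l \<in> I" "m \<in> I" "l \<noteq> m" for l m
    proof -
      have "card (\<A> l) * card (\<A> m) \<le> b l * b m"
        using pair[OF that] le_b that by (auto intro: mult_le_mono)
      then have "real (card (\<A> l)) * real (card (\<A> m)) \<le> real (b l) * real (b m)"
        by (metis of_nat_le_iff of_nat_mult)
      then show ?thesis
        using bpos that by (simp add: x_def)
    qed
    moreover have "x i * x j < 1"
    proof -
      have "real (card (\<A> i)) * real (card (\<A> j)) < real (b i) * real (b j)"
        using ij(4) by (metis of_nat_less_iff of_nat_mult)
      then show ?thesis
        using bpos ij by (simp add: x_def)
    qed
    ultimately have "(\<Prod>i\<in>I. x i) < 1"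
      using ij by (intro prod_less_1_of_pairs[of I i j]) (auto simp: x_def)
    moreover have "0 < (\<Prod>i\<in>I. real (b i))"
      using bpos by (intro prod_pos) auto
    ultimately have "(\<Prod>i\<in>I. real (card (\<A> i))) < (\<Prod>i\<in>I. real (b i))"
      by (simp add: x_def prod_dividef)
    then have "(\<Prod>i\<in>I. card (\<A> i)) < (\<Prod>i\<in>I. b i)"
      by (metis of_nat_less_iff of_nat_prod)
    then show ?thesis
      by simp
  next
    case False
    then have ex: "\<exists>T\<in>[X]\<^bsup>t\<^esup>. \<A> i \<subseteq> star X (r i) T \<and> \<A> j \<subseteq> star X (r j) T"
      if "i \<in> I" "j \<in> I" "i \<noteq> j" for i j
      using pair that by blast
    have le: "card (\<A> i) \<le> b i" if "i \<in> I" for i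
    proof -
      \<comment> \<open>As \<open>k \<ge> 2\<close>, each index has a partner, and the
        \<open>t\<close>-set of that pair bounds \<open>\<A> i\<close> by a star.\<close>
      obtain j where "j \<in> I" "j \<noteq> i"
        using k(1,2) by (cases "i = 1") auto
      then show ?thesis
        using ex that le_b by blast
    qed
    show ?thesis
    proof (intro conjI impI)
      show "(\<Prod>i\<in>I. card (\<A> i)) \<le> (\<Prod>i\<in>I. b i)"
        using le by (intro prod_mono) auto
    next
      assume eq: "(\<Prod>i\<in>I. card (\<A> i)) = (\<Prod>i\<in>I. b i)"
      \<comment> \<open>All bounds are positive, so a deficit in one factor could not be made up by
        the others.\<close>
      have card_eq: "card (\<A> i) = b i" if "i \<in> I" for i
      proof (rule ccontr)
        assume "card (\<A> i) \<noteq> b i"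
        then have "card (\<A> i) < b i"
          using le[OF that] by simp
        moreover have "(\<Prod>j\<in>I - {i}. card (\<A> j)) \<le> (\<Prod>j\<in>I - {i}. b j)"
          using le by (intro prod_mono) auto
        moreover have "0 < (\<Prod>j\<in>I - {i}. b j)"
          using bpos by (intro prod_pos) auto
        ultimately have "card (\<A> i) * (\<Prod>j\<in>I - {i}. card (\<A> j)) < b i * (\<Prod>j\<in>I - {i}. b j)"
          by (meson le_less_trans mult_le_mono2 mult_less_mono1)
        then show False
          using eq prod.remove[OF I that, of "\<lambda>i. card (\<A> i)"] prod.remove[OF I that, of b]
          by simp
      qed
      obtain T where T: "T \<in> [X]\<^bsup>t\<^esup>" "\<A> 1 \<subseteq> star X (r 1) T" "\<A> 2 \<subseteq> star X (r 2) T"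
        using ex[of 1 2] k by auto
      have A1: "\<A> 1 = star X (r 1) T"
        by (rule eq_star[OF T(1,2) k(1) card_eq[OF k(1)]])
      have "\<A> i = star X (r i) T" if "i \<in> I" for i
      proof (cases "i = 1")
        \<comment> \<open>The pair \<open>1, i\<close> may come with its own \<open>T'\<close>, but
          \<open>\<A> 1\<close> is the full star of both \<open>T\<close> and \<open>T'\<close>, so
          the two coincide.\<close>
        case False
        then obtain T' where T': "T' \<in> [X]\<^bsup>t\<^esup>" "\<A> 1 \<subseteq> star X (r 1) T'" "\<A> i \<subseteq> star X (r i) T'"
          using ex[OF k(1) \<open>i \<in> I\<close>] by metis
        then have "star X (r 1) T = star X (r 1) T'"
          using eq_star[OF T'(1,2) k(1) card_eq[OF k(1)]] A1 by simp
        then have "T = T'"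
          using star_inject[of X T t T' "r 1"] T T' tr rn k by simp
        then show ?thesis
          using eq_star[OF T'(1,3) that card_eq[OF that]] by simp
      qed (use A1 in simp)
      then show "\<exists>T\<in>[X]\<^bsup>t\<^esup>. \<forall>i\<in>I. \<A> i = star X (r i) T"
        using T(1) by blast
    qed
  qed
  then show ?thesis
    using eq_if unfolding X_def I_def b_def star_def by blast
qed

end
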